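(* Consider the line network model (see context) with $\ell$ links and erasure probabilities $p_1,\dots,p_\ell$, and assume there is a unique worst link: there is an index $m$ with $p_m:=\max_{1\le i\le \ell}p_i<1$ and $p_i<p_m$ for all $i\neq m$. For $n\ge 1$ define the delay function $$D(n,p_1,\dots,p_\ell):=\mathbb{E}T_n-\frac{n}{1-p_m},$$ so that $\mathbb{E}T_n=\frac{n}{1-\max_i p_i}+D(n,p_1,\dots,p_\ell)$. Then $n\mapsto D(n,p_1,\dots,p_\ell)$ is non-decreasing in $n$, and for every $n\ge1$ $$D(n,p_1,\dots,p_\ell)\le \bar D(p_1,\dots,p_\ell):=\sum_{i=1,\,i\neq m}^{\ell}\frac{p_m}{p_m-p_i}.$$
   Context: Line network model. Fix integers $\ell\ge1$, $n\ge1$ and erasure probabilities $p_1,\dots,p_\ell\in[0,1)$. Let $\{z_{t,i}: t\ge1,\,1\le i\le\ell\}$ be independent Bernoulli random variables with $\mathbb{P}(z_{t,i}=1)=1-p_i$ ($z_{t,i}=1$ means link $i$ is ON at time step $t$, $z_{t,i}=0$ means the packet sent on it at step $t$ is erased). There are nodes $N^{(1)},\dots,N^{(\ell+1)}$, link $i$ going from $N^{(i)}$ to $N^{(i+1)}$; the source $N^{(1)}$ holds $n$ packets, and at every time step each node $N^{(i)}$, $i\le \ell$, sends over link $i$ a random linear combination of all packets it has received (idealized so that a transmission is innovative whenever possible). Let $\rho_i(t)$ be the rank (dimension of the span of packets held) of node $N^{(i)}$ after $t$ time steps: $\rho_1(t)=n$ for all $t\ge0$, $\rho_i(0)=0$ for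 $2\le i\le \ell+1$, and for $t\ge1$, $1\le i\le\ell$, $$\rho_{i+1}(t)=\rho_{i+1}(t-1)+z_{t,i}\,\mathbf 1\{\rho_i(t-1)>\rho_{i+1}(t-1)\}.$$ The rank difference $\rho_i-\rho_{i+1}$ is the number of innovative packets at node $N^{(i)}$. The completion time is $T_n:=\min\{t\ge0:\rho_{\ell+1}(t)=n\}$, the time for the destination $N^{(\ell+1)}$ to be able to decode all $n$ packets. *)

theory Defs
  imports "HOL-Probability.Probability"
begin

text \<open>Sample space: \<open>\<omega> (t, i)\<close> is the ON/OFF state \<open>z_{t,i}\<close> of link i at time step t.
  Links are indexed 1..l; other indices are irrelevant dummies.\<close>

definition line_space :: "(nat \<Rightarrow> real) \<Rightarrow> (nat \<times> nat \<Rightarrow> bool) measure" where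
  "line_space p = PiM UNIV (\<lambda>(t, i). measure_pmf (bernoulli_pmf (1 - p i)))"

text \<open>\<open>rank \<omega> n i t\<close> = rank of node \<open>N^(i)\<close> after t steps (nodes 1..l+1).\<close>
fun rank :: "(nat \<times> nat \<Rightarrow> bool) \<Rightarrow> nat \<Rightarrow> nat \<Rightarrow> nat \<Rightarrow> nat" where
  "rank \<omega> n i 0 = (if i = 1 then n else 0)"
| "rank \<omega> n i (Suc t) =
     (if i = 1 then n
      else if 2 \<le> i then rank \<omega> n i t +
             (if \<omega> (Suc t, i - 1) \<and> rank \<omega> n (i - 1) t > rank \<omega> n i t then 1 else 0)
      else 0)"

definition completion_time :: "nat \<Rightarrow> nat \<Rightarrow> (nat \<times> nat \<Rightarrow> bool) \<Rightarrow> ennreal" where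
  "completion_time l n \<omega> =
     (if \<exists>t. rank \<omega> n (l + 1) t = n then of_nat (LEAST t. rank \<omega> n (l + 1) t = n) else \<infinity>)"

definition expected_T :: "nat \<Rightarrow> (nat \<Rightarrow> real) \<Rightarrow> nat \<Rightarrow> ennreal" where
  "expected_T l p n = (\<integral>\<^sup>+ \<omega>. completion_time l n \<omega> \<partial>line_space p)"

text \<open>Delay function \<open>D(n) = E T_n - n/(1 - p_m)\<close> (meaningful when \<open>E T_n < \<infinity>\<close>).\<close>
definition delay :: "nat \<Rightarrow> (nat \<Rightarrow> real) \<Rightarrow> nat \<Rightarrow> nat \<Rightarrow> real" where
  "delay l p m n = enn2real (expected_T l p n) - real n / (1 - p m)"

definition delay_bound :: "nat \<Rightarrow> (nat \<Rightarrow> real) \<Rightarrow> nat \<Rightarrow> real" where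
  "delay_bound l p m = (\<Sum>i\<in>{1..l} - {m}. p m / (p m - p i))"

end

theory Submission
  imports Defs
begin

text \<open>
  The \<open>k\<close>-th innovative packet crosses link \<open>i\<close> at the first ON step after both the arrival of
  that packet at the node and the departure of its predecessor. Hence the crossing times follow the
  recursion of directed last passage percolation with independent geometric weights \<open>w (i, k)\<close>, the
  number of transmissions packet \<open>k\<close> needs on link \<open>i\<close>. For a fixed matrix \<open>w\<close>, the outcomes
  realising it form a cylinder set whose probability is the geometric product weight, so
  \<open>E T_n\<close> is the mean passage time.

  Monotonicity: deleting the first packet can only enlarge the last gap between departures, so
  \<open>n \<mapsto> E T_n\<close> is concave. Since \<open>E T_n \<ge> n / (1 - p_m)\<close>, every increment is at least
  \<open>1 / (1 - p_m)\<close>.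

  Upper bound: letting the worst link always have packets to send bounds the delay by that of the
  links up to \<open>m\<close> plus that of the links from \<open>m\<close> on. Rotating the weight matrix by 180 degrees turns
  the first part into a network whose first link is the worst, like the second. For such a network,
  start every queue in its stationary law. By a discrete Burke theorem the sojourn time at
  link \<open>i\<close> stays geometric with parameter \<open>p_i / p_m\<close>, hence has mean \<open>p_m / (p_m - p_i)\<close>.
\<close>

section \<open>Last passage percolation\<close>

text \<open>\<open>lpp w i k\<close> is the time at which packet \<open>k\<close> completes its
  crossing of link \<open>i\<close>. The zero row puts all packets at the source at time 0; the zero
  column gives packet 1 no predecessor to wait for.\<close>

fun lpp :: "(nat \<times> nat \<Rightarrow> nat) \<Rightarrow> nat \<Rightarrow> nat \<Rightarrow> nat" where
  "lpp w 0 k = 0"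
| "lpp w (Suc i) 0 = 0"
| "lpp w (Suc i) (Suc k) = max (lpp w i (Suc k)) (lpp w (Suc i) k) + w (Suc i, Suc k)"

lemma lpp_0_right [simp]: "lpp w i 0 = 0"
  by (cases i) auto

lemma lpp_cong:
  assumes "\<And>x. x \<in> {1..i} \<times> {1..k} \<Longrightarrow> w x = w' x"
  shows "lpp w i k = lpp w' i k"
  using assms by (induction w i k rule: lpp.induct) auto

lemma lpp_Suc_row: "lpp w i k \<le> lpp w (Suc i) k"
  by (cases k) auto

lemma lpp_Suc_column: "lpp w i k \<le> lpp w i (Suc k)"
  by (cases i) auto

lemma lpp_mono:
  assumes "i \<le> i'" "k \<le> k'"
  shows "lpp w i k \<le> lpp w i' k'"
  using lift_Suc_mono_le[of "\<lambda>i. lpp w i k", OF lpp_Suc_row assms(1)]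
    lift_Suc_mono_le[of "lpp w i'", OF lpp_Suc_column assms(2)] by linarith

lemma lpp_row_1: "lpp w (Suc 0) k = (\<Sum>j=1..k. w (Suc 0, j))"
  by (induction k) auto

lemma lpp_column_1: "lpp w i (Suc 0) = (\<Sum>j=1..i. w (j, Suc 0))"
  by (induction i) auto

lemma sum_row_le_lpp: "(\<Sum>j=1..k. w (Suc i, j)) \<le> lpp w (Suc i) k"
proof (induction k)
  case (Suc k)
  then have "(\<Sum>j=1..k. w (Suc i, j)) \<le> max (lpp w i (Suc k)) (lpp w (Suc i) k)" by simp
  then show ?case by simp
qed simp

lemma lpp_le_sum: "lpp w i k \<le> (\<Sum>x\<in>{1..i} \<times> {1..k}. w x)"
proof (induction w i k rule: lpp.induct)
  case (3 w i k)
  have fin: "finite ({1..Suc i} \<times> {1..Suc k})" by simp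
  have "(\<Sum>x\<in>insert (Suc i, Suc k) ({1..i} \<times> {1..Suc k}). w x) \<le> (\<Sum>x\<in>{1..Suc i} \<times> {1..Suc k}. w x)"
    by (intro sum_mono2 fin) auto
  moreover have "(\<Sum>x\<in>insert (Suc i, Suc k) ({1..Suc i} \<times> {1..k}). w x) \<le> (\<Sum>x\<in>{1..Suc i} \<times> {1..Suc k}. w x)"
    by (intro sum_mono2 fin) auto
  ultimately show ?case using 3 by simp
qed auto

section \<open>Passage times under deletion, saturation and rotation\<close>

text \<open>Both claims are proved together along the rows: larger arrival gaps and shorter sojourns
  at a link give larger departure gaps, and these are the arrival gaps that shorten the sojourns at
  the next link. Sums replace differences to avoid truncated subtraction.\<close>

lemma lpp_delete_column:
  fixes w :: "nat \<times> nat \<Rightarrow> nat"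
  defines "w' \<equiv> \<lambda>(i, k). w (i, Suc k)"
  shows "lpp w' (Suc i) k + lpp w i (Suc k) \<le> lpp w (Suc i) (Suc k) + lpp w' i k"
    and "lpp w i (Suc (Suc k)) + lpp w' i k \<le> lpp w' i (Suc k) + lpp w i (Suc k)"
proof -
  have "(\<forall>k. lpp w' (Suc i) k + lpp w i (Suc k) \<le> lpp w (Suc i) (Suc k) + lpp w' i k) \<and>
        (\<forall>k. lpp w i (Suc (Suc k)) + lpp w' i k \<le> lpp w' i (Suc k) + lpp w i (Suc k))" for i
  proof (induction i)
    case 0
    have "lpp w' (Suc 0) k \<le> lpp w (Suc 0) (Suc k)" for k
      by (induction k) (auto simp: w'_def)
    then show ?case by simp
  next
    case (Suc i)
    \<comment> \<open>A departure gap is the packet's own weight plus the positive part of its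
      arrival gap minus its predecessor's sojourn.\<close>
    have B: "lpp w (Suc i) (Suc (Suc k)) + lpp w' (Suc i) k
        \<le> lpp w' (Suc i) (Suc k) + lpp w (Suc i) (Suc k)" for k
      using spec[OF conjunct1[OF Suc], of k] spec[OF conjunct2[OF Suc], of k] by (simp add: w'_def)
    \<comment> \<open>Lindley recursion: a sojourn is the packet's own weight plus the positive part
      of its predecessor's sojourn minus the arrival gap; \<open>B\<close> compares the arrival
      gaps.\<close>
    have "lpp w' (Suc (Suc i)) k + lpp w (Suc i) (Suc k)
        \<le> lpp w (Suc (Suc i)) (Suc k) + lpp w' (Suc i) k" for k
    proof (induction k)
      case 0
      then show ?case using lpp_Suc_row[of w "Suc i" "Suc 0"] by simp
    next
      case (Suc k)
      then show ?case using B[of k]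
        lpp.simps(3)[of w' "Suc i" k] lpp.simps(3)[of w "Suc i" "Suc k"]
        by (simp add: w'_def del: lpp.simps)
    qed
    with B show ?case by blast
  qed
  then show "lpp w' (Suc i) k + lpp w i (Suc k) \<le> lpp w (Suc i) (Suc k) + lpp w' i k"
    and "lpp w i (Suc (Suc k)) + lpp w' i k \<le> lpp w' i (Suc k) + lpp w i (Suc k)" by blast+
qed

text \<open>\<open>w'\<close> consists of the rows from \<open>Suc m\<close> on: its first row behaves as if all packets were available at
  time 0. Compared with this, the real arrivals at the later rows are more spread out, so the time
  spent there is not larger.\<close>

lemma lpp_saturate:
  fixes w :: "nat \<times> nat \<Rightarrow> nat" and m :: nat
  defines "w' \<equiv> \<lambda>(j, k). w (m + j, k)"
  shows "lpp w (m + Suc j) k + lpp w' (Suc 0) k \<le> lpp w (Suc m) k + lpp w' (Suc j) k"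
proof (induction j arbitrary: k)
  case 0
  then show ?case by simp
next
  case (Suc j)
  note outer = Suc
  show ?case
  proof (induction k)
    case (Suc k)
    have "lpp w' (Suc 0) (Suc k) = lpp w' (Suc 0) k + w (Suc m, Suc k)"
      by (simp add: w'_def)
    moreover have "lpp w (Suc m) k + w (Suc m, Suc k) \<le> lpp w (Suc m) (Suc k)" by simp
    ultimately show ?case
      using Suc outer[of "Suc k"] lpp.simps(3)[of w "m + Suc j" k] lpp.simps(3)[of w' "Suc j" k]
      by (simp add: w'_def del: lpp.simps)
  qed simp
qed

text \<open>A path read backwards is a path through the rotated matrix. The proof follows the
  recursion instead of handling paths.\<close>

lemma lpp_reverse:
  fixes w :: "nat \<times> nat \<Rightarrow> nat" and m n :: nat
  defines "w' \<equiv> \<lambda>(i, k). w (Suc m - i, Suc n - k)"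
  shows "lpp w m n \<le> lpp w' m n"
proof -
  \<comment> \<open>A best path up to the cell and a best path onward from it, the latter measured
    in \<open>w'\<close>, both count the weight of the cell; hence the extra weight on the
    right.\<close>
  have "lpp w (Suc i) (Suc k) + lpp w' (m - i) (n - k) \<le> lpp w' m n + w (Suc i, Suc k)"
    if "i < m" "k < n" for i k
    using that
  proof (induction "i + k" arbitrary: i k rule: less_induct)
    case less
    have row: "lpp w i (Suc k) + lpp w' (m - i) (n - k) \<le> lpp w' m n"
    proof (cases i)
      case 0
      then show ?thesis using lpp_mono[of m m "n - k" n w'] by simp
    next
      case (Suc i')
      have "lpp w (Suc i') (Suc k) + lpp w' (m - i') (n - k) \<le> lpp w' m n + w (Suc i', Suc k)"
        using less Suc by auto
      moreover have "m - i' = Suc (m - i)" "n - k = Suc (n - Suc k)" using less.prems Suc by auto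
      moreover have "w' (Suc (m - i), Suc (n - Suc k)) = w (Suc i', Suc k)"
        using less.prems Suc by (simp add: w'_def)
      ultimately have "lpp w' (m - i) (n - k) + w (Suc i', Suc k) \<le> lpp w' (m - i') (n - k)"
        and "lpp w i (Suc k) + lpp w' (m - i') (n - k) \<le> lpp w' m n + w (Suc i', Suc k)"
        using Suc by simp_all
      then show ?thesis by linarith
    qed
    have column: "lpp w (Suc i) k + lpp w' (m - i) (n - k) \<le> lpp w' m n"
    proof (cases k)
      case 0
      then show ?thesis using lpp_mono[of "m - i" m n n w'] by simp
    next
      case (Suc k')
      have "lpp w (Suc i) (Suc k') + lpp w' (m - i) (n - k') \<le> lpp w' m n + w (Suc i, Suc k')"
        using less Suc by auto
      moreover have "n - k' = Suc (n - k)" "m - i = Suc (m - Suc i)" using less.prems Suc by auto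
      moreover have "w' (Suc (m - Suc i), Suc (n - k)) = w (Suc i, Suc k')"
        using less.prems Suc by (simp add: w'_def)
      ultimately have "lpp w' (m - i) (n - k) + w (Suc i, Suc k') \<le> lpp w' (m - i) (n - k')"
        and "lpp w (Suc i) k + lpp w' (m - i) (n - k') \<le> lpp w' m n + w (Suc i, Suc k')"
        using Suc by simp_all
      then show ?thesis by linarith
    qed
    show ?case using row column by simp
  qed
  from this[of "m - 1" "n - 1"] show ?thesis
    by (cases m; cases n) (auto simp: w'_def split: if_splits)
qed

section \<open>Geometric weights\<close>

text \<open>\<open>geometric_pmf\<close> counts failures and takes the success probability, hence
  \<open>Suc\<close> and \<open>1 - q\<close>; \<open>q\<close> is the erasure probability.\<close>

definition trials :: "real \<Rightarrow> nat pmf" where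
  "trials q = map_pmf Suc (geometric_pmf (1 - q))"

lemma pmf_trials:
  assumes "0 \<le> q" "q < 1"
  shows "pmf (trials q) k = (if k = 0 then 0 else q ^ (k - 1) * (1 - q))"
proof (cases k)
  case 0
  then show ?thesis by (auto simp: trials_def pmf_eq_0_set_pmf)
next
  case (Suc j)
  have "pmf (map_pmf Suc (geometric_pmf (1 - q))) (Suc j) = pmf (geometric_pmf (1 - q)) j"
    by (rule pmf_map_inj') simp
  then show ?thesis using assms Suc by (simp add: trials_def)
qed

lemma integrable_trials:
  assumes "0 \<le> q" "q < 1"
  shows "integrable (trials q) real"
  using integrable_real_geometric_pmf[of "1 - q"] assms
  by (simp add: trials_def integrable_map_pmf_eq)

lemma expectation_trials:
  assumes "0 \<le> q" "q < 1"
  shows "measure_pmf.expectation (trials q) real = 1 / (1 - q)"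
  using integrable_real_geometric_pmf[of "1 - q"] expectation_geometric_pmf[of "1 - q"] assms
  by (simp add: trials_def field_simps)

text \<open>For geometric \<open>u\<close> and \<open>d\<close>, \<open>min u d\<close> is geometric and independent of \<open>u - d\<close>; replacing it by an
  independent copy \<open>c\<close> leaves the joint law unchanged.\<close>

lemma geometric_burke:
  assumes "0 < a" "a < 1" "0 \<le> r" "r < 1"
  shows "map_pmf (\<lambda>((u, d), c). (u - d + c, d - u + c))
      (pair_pmf (pair_pmf (geometric_pmf (1 - r)) (geometric_pmf (1 - a))) (geometric_pmf (1 - a * r))) =
    pair_pmf (geometric_pmf (1 - r)) (geometric_pmf (1 - a))" (is "map_pmf ?f ?P = ?Q")
proof (rule pmf_eqI)
  fix z :: "nat \<times> nat"
  obtain x y where z: "z = (x, y)" by fastforce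
  \<comment> \<open>The fibre over \<open>(x, y)\<close>, indexed by \<open>j = min u d\<close>: the
    differences \<open>u - d\<close> and \<open>d - u\<close> and the value
    \<open>c = min x y\<close> are forced.\<close>
  define h where "h = (\<lambda>j. ((j + (x - y), j + (y - x)), min x y))"
  have ar: "0 \<le> a * r" "a * r < 1"
    using assms mult_strict_mono'[of a 1 r 1] by auto
  have inj: "inj h" by (auto simp: h_def inj_on_def)
  have preimage: "?f -` {z} = range h"
  proof (intro equalityI subsetI)
    fix t assume "t \<in> ?f -` {z}"
    then obtain u d c where t: "t = ((u, d), c)" "u - d + c = x" "d - u + c = y"
      by (cases t) (auto simp: z)
    then have "t = h (min u d)" by (auto simp: h_def min_def)
    then show "t \<in> range h" by blast
  qed (auto simp: h_def z)
  \<comment> \<open>Along the fibre the mass decays with ratio \<open>a * r\<close>; the factor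
    \<open>1 - a * r\<close> makes the series sum to the target mass.\<close>
  have pmf_h: "pmf ?P (h j) = (a * r) ^ j * (pmf ?Q z * (1 - a * r))" for j
  proof -
    have "r ^ (x - y) * a ^ (y - x) * (a * r) ^ min x y = r ^ x * a ^ y"
      by (cases "x \<le> y")
        (auto simp: min_def power_mult_distrib simp flip: power_add)
    moreover have "pmf ?P (h j) = (a * r) ^ j * ((r ^ (x - y) * a ^ (y - x) * (a * r) ^ min x y)
        * (1 - r) * (1 - a) * (1 - a * r))"
      using assms ar unfolding h_def pmf_pair
      by (subst (1 2 3) pmf_geometric) (simp_all add: power_add power_mult_distrib)
    ultimately show ?thesis using assms z by (simp add: pmf_pair)
  qed
  have sums: "(\<lambda>j. pmf ?P (h j)) sums pmf ?Q z"
    unfolding pmf_h using sums_mult2[OF geometric_sums[of "a * r"], of "pmf ?Q z * (1 - a * r)"] ar by simp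
  have "ennreal (pmf (map_pmf ?f ?P) z) = emeasure ?P (range h)"
    by (simp add: pmf_map preimage measure_pmf.emeasure_eq_measure)
  also have "\<dots> = (\<integral>\<^sup>+t. pmf ?P t \<partial>count_space (range h))"
    by (simp add: nn_integral_pmf)
  also have "\<dots> = (\<integral>\<^sup>+j. pmf ?P (h j) \<partial>count_space UNIV)"
    using inj by (intro nn_integral_bij_count_space[symmetric]) (simp add: inj_on_imp_bij_betw)
  also have "\<dots> = (\<Sum>j. ennreal (pmf ?P (h j)))"
    by (rule nn_integral_count_space_nat)
  also have "\<dots> = ennreal (pmf ?Q z)"
    using sums by (intro suminf_ennreal_eq pmf_nonneg)
  finally show "pmf (map_pmf ?f ?P) z = pmf ?Q z" by simp
qed

text \<open>The shift by one cancels in the differences and passes from \<open>c\<close> to both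
  outputs.\<close>

lemma trials_burke:
  assumes "0 < a" "a < 1" "0 \<le> r" "r < 1"
  shows "map_pmf (\<lambda>((u, d), c). (u - d + c, d - u + c))
      (pair_pmf (pair_pmf (trials r) (trials a)) (trials (a * r))) =
    pair_pmf (trials r) (trials a)"
proof -
  have "map_pmf (\<lambda>((u, d), c). (u - d + c, d - u + c))
      (pair_pmf (pair_pmf (trials r) (trials a)) (trials (a * r))) =
    map_pmf (map_prod Suc Suc) (map_pmf (\<lambda>((u, d), c). (u - d + c, d - u + c))
      (pair_pmf (pair_pmf (geometric_pmf (1 - r)) (geometric_pmf (1 - a))) (geometric_pmf (1 - a * r))))"
    unfolding trials_def map_pair[symmetric] pmf.map_comp
    by (intro map_pmf_cong) (auto simp: map_prod_def)
  also have "\<dots> = map_pmf (map_prod Suc Suc) (pair_pmf (geometric_pmf (1 - r)) (geometric_pmf (1 - a)))"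
    by (simp only: geometric_burke[OF assms])
  also have "\<dots> = pair_pmf (trials r) (trials a)"
    unfolding trials_def by (simp add: map_prod_def map_pair)
  finally show ?thesis .
qed

section \<open>Independent weights and their reindexing\<close>

text \<open>Pulling an outcome \<open>g\<close> back along the injection constrains only the
  coordinates in the image of \<open>B\<close>; the others are free and contribute the factor
  1.\<close>

lemma Pi_pmf_reindex:
  assumes "finite A" "finite B" and inj: "inj_on h B" and sub: "h ` B \<subseteq> A"
    and q: "\<And>x. x \<in> B \<Longrightarrow> q x = p (h x)"
  shows "Pi_pmf B d q = map_pmf (\<lambda>f x. if x \<in> B then f (h x) else d) (Pi_pmf A d p)"
proof (rule pmf_eqI)
  fix g
  let ?F = "\<lambda>f x. if x \<in> B then f (h x) else d"
  show "pmf (Pi_pmf B d q) g = pmf (map_pmf ?F (Pi_pmf A d p)) g"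
  proof (cases "\<forall>x. x \<notin> B \<longrightarrow> g x = d")
    case False
    then have "?F -` {g} = {}" by fastforce
    with False show ?thesis using assms by (auto simp: pmf_Pi pmf_map)
  next
    case True
    define C where "C y = (if y \<in> h ` B then {g (the_inv_into B h y)} else UNIV)" for y
    have "?F -` {g} = Pi A C"
      using True sub by (fastforce simp: C_def Pi_def fun_eq_iff the_inv_into_f_f[OF inj])
    then have "pmf (map_pmf ?F (Pi_pmf A d p)) g = (\<Prod>y\<in>A. measure_pmf.prob (p y) (C y))"
      using assms by (simp add: pmf_map measure_Pi_pmf_Pi)
    also have "\<dots> = (\<Prod>y\<in>h ` B. measure_pmf.prob (p y) (C y))"
      using assms by (intro prod.mono_neutral_right) (auto simp: C_def)
    also have "\<dots> = (\<Prod>x\<in>B. pmf (q x) (g x))"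
      by (simp add: prod.reindex[OF inj] C_def q the_inv_into_f_f[OF inj] measure_pmf_single)
    finally show ?thesis using True assms by (simp add: pmf_Pi)
  qed
qed

lemma
  fixes q :: "'a \<Rightarrow> nat pmf"
  assumes "finite A" "x \<in> A" "integrable (q x) real"
  shows integrable_Pi_pmf_component: "integrable (Pi_pmf A 0 q) (\<lambda>w. real (w x))"
    and expectation_Pi_pmf_component:
      "measure_pmf.expectation (Pi_pmf A 0 q) (\<lambda>w. real (w x)) = measure_pmf.expectation (q x) real"
proof -
  have q: "q x = map_pmf (\<lambda>w. w x) (Pi_pmf A 0 q)"
    using assms by (simp add: Pi_pmf_component)
  show "integrable (Pi_pmf A 0 q) (\<lambda>w. real (w x))"
    using assms(3) by (subst (asm) q) (simp add: integrable_map_pmf_eq)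
  show "measure_pmf.expectation (Pi_pmf A 0 q) (\<lambda>w. real (w x)) = measure_pmf.expectation (q x) real"
    by (subst q) simp
qed

lemma integrable_lpp:
  fixes q :: "'a \<Rightarrow> nat pmf"
  assumes "finite A" "h ` ({1..i} \<times> {1..k}) \<subseteq> A" "\<And>x. x \<in> A \<Longrightarrow> integrable (q x) real"
  shows "integrable (Pi_pmf A 0 q) (\<lambda>w. real (lpp (\<lambda>x. w (h x)) i k))"
proof (rule Bochner_Integration.integrable_bound)
  show "integrable (Pi_pmf A 0 q) (\<lambda>w. \<Sum>x\<in>{1..i} \<times> {1..k}. real (w (h x)))"
    using assms by (intro Bochner_Integration.integrable_sum integrable_Pi_pmf_component) auto
  show "AE w in Pi_pmf A 0 q. norm (real (lpp (\<lambda>x. w (h x)) i k))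
      \<le> norm (\<Sum>x\<in>{1..i} \<times> {1..k}. real (w (h x)))"
    using lpp_le_sum by (simp flip: of_nat_sum)
qed simp

definition passage_law :: "(nat \<Rightarrow> real) \<Rightarrow> nat \<Rightarrow> nat \<Rightarrow> (nat \<times> nat \<Rightarrow> nat) pmf" where
  "passage_law p l n = Pi_pmf ({1..l} \<times> {1..n}) 0 (\<lambda>(i, k). trials (p i))"

definition mean_lpp :: "(nat \<Rightarrow> real) \<Rightarrow> nat \<Rightarrow> nat \<Rightarrow> real" where
  "mean_lpp p l n = measure_pmf.expectation (passage_law p l n) (\<lambda>w. real (lpp w l n))"

lemma mean_lpp_nonneg: "0 \<le> mean_lpp p l n"
  unfolding mean_lpp_def by (rule Bochner_Integration.integral_nonneg) simp

text \<open>Coupling tool: several networks are read off one random matrix, each through its own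
  \<open>h\<close>, and can then be compared pointwise.\<close>

lemma expectation_lpp_reindex:
  assumes "finite A" and inj: "inj_on h ({1..l} \<times> {1..n})" and sub: "h ` ({1..l} \<times> {1..n}) \<subseteq> A"
    and q: "\<And>i k. i \<in> {1..l} \<Longrightarrow> k \<in> {1..n} \<Longrightarrow> q (h (i, k)) = trials (p i)"
  shows "measure_pmf.expectation (Pi_pmf A 0 q) (\<lambda>w. real (lpp (\<lambda>x. w (h x)) l n)) = mean_lpp p l n"
proof -
  let ?B = "{1..l} \<times> {1..n}"
  have "passage_law p l n = map_pmf (\<lambda>f x. if x \<in> ?B then f (h x) else 0) (Pi_pmf A 0 q)"
    unfolding passage_law_def using assms by (intro Pi_pmf_reindex) auto
  then have "mean_lpp p l n = measure_pmf.expectation (Pi_pmf A 0 q)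
      (\<lambda>w. real (lpp (\<lambda>x. if x \<in> ?B then w (h x) else 0) l n))"
    by (simp add: mean_lpp_def)
  also have "(\<lambda>w. lpp (\<lambda>x. if x \<in> ?B then w (h x) else 0) l n) = (\<lambda>w. lpp (\<lambda>x. w (h x)) l n)"
    by (intro ext lpp_cong) auto
  finally show ?thesis by simp
qed

section \<open>Stationarity when the first link is the worst\<close>

lemma mean_lpp_row_1:
  assumes "0 \<le> p (Suc 0)" "p (Suc 0) < 1"
  shows "mean_lpp p (Suc 0) n = real n / (1 - p (Suc 0))"
proof -
  have "mean_lpp p (Suc 0) n = measure_pmf.expectation (passage_law p (Suc 0) n)
      (\<lambda>w. \<Sum>j=1..n. real (w (Suc 0, j)))"
    by (simp add: mean_lpp_def lpp_row_1)
  also have "\<dots> = (\<Sum>j=1..n. 1 / (1 - p (Suc 0)))"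
    unfolding passage_law_def using integrable_trials[OF assms] expectation_trials[OF assms]
    by (subst Bochner_Integration.integral_sum)
      (auto intro!: sum.cong integrable_Pi_pmf_component simp: expectation_Pi_pmf_component)
  finally show ?thesis by simp
qed

locale bottleneck_first =
  fixes a :: real and h :: nat and p :: "nat \<Rightarrow> real"
  assumes a: "0 < a" "a < 1" and p1: "p (Suc 0) = a"
    and p: "\<And>i. i \<in> {2..h} \<Longrightarrow> 0 \<le> p i \<and> p i < a"
begin

text \<open>Column 1 carries the stationary sojourn times and plays the role of a virtual packet 0.\<close>

definition q :: "nat \<times> nat \<Rightarrow> nat pmf" where
  "q = (\<lambda>(i, k). trials (if k = Suc 0 \<and> i \<noteq> Suc 0 then p i / a else p i))"

text \<open>The ratio \<open>p i / a\<close> is the \<open>r\<close> for which the third parameter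
  \<open>a * r\<close> of \<open>trials_burke\<close> becomes \<open>p i\<close>.\<close>

definition sojourn_law :: "(nat \<Rightarrow> nat) pmf" where
  "sojourn_law = Pi_pmf {2..h} 0 (\<lambda>i. trials (p i / a))"

definition sojourns :: "nat \<Rightarrow> (nat \<times> nat \<Rightarrow> nat) \<Rightarrow> nat \<Rightarrow> nat" where
  "sojourns k w = (\<lambda>j. if j \<in> {2..h} then lpp w j k - lpp w (j - 1) k else 0)"

text \<open>The state after the cells of \<open>front_cells i k\<close> (columns \<open>1..k\<close> and the first \<open>i\<close> cells of the next) have
  been processed: the sojourn times along the front, and the gap between the last two departures
  from row \<open>i\<close>.\<close>

definition front :: "nat \<Rightarrow> nat \<Rightarrow> (nat \<times> nat \<Rightarrow> nat) \<Rightarrow> (nat \<Rightarrow> nat) \<times> nat" where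
  "front i k w = (\<lambda>j. if j \<le> i then sojourns (Suc k) w j else sojourns k w j,
     lpp w i (Suc k) - lpp w i k)"

definition front_cells :: "nat \<Rightarrow> nat \<Rightarrow> (nat \<times> nat) set" where
  "front_cells i k = {1..h} \<times> {1..k} \<union> {1..i} \<times> {Suc k}"

lemma finite_front_cells [simp]: "finite (front_cells i k)"
  by (simp add: front_cells_def)

lemma front_cells_Suc: "front_cells (Suc i) k = insert (Suc i, Suc k) (front_cells i k)"
  by (auto simp: front_cells_def)

lemma front_1:
  "front (Suc 0) k (w((Suc 0, Suc k) := c)) = (sojourns k w, c)"
proof -
  let ?w = "w((Suc 0, Suc k) := c)"
  have "lpp ?w i k = lpp w i k" for i
    by (intro lpp_cong) auto
  then show ?thesis
    by (auto simp: front_def sojourns_def fun_eq_iff)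
qed

text \<open>With \<open>u (Suc i)\<close> the predecessor's sojourn and \<open>d\<close> the arrival
  gap, \<open>u (Suc i) - d\<close> is the waiting time of the packet and
  \<open>d - u (Suc i)\<close> the idle time of the link. This is the map of
  \<open>trials_burke\<close>.\<close>

lemma front_Suc:
  assumes "Suc i \<in> {2..h}"
  shows "front (Suc i) k (w((Suc i, Suc k) := c)) =
    (case front i k w of (u, d) \<Rightarrow> (u(Suc i := u (Suc i) - d + c), d - u (Suc i) + c))"
proof -
  let ?w = "w((Suc i, Suc k) := c)"
  have column: "lpp ?w j k = lpp w j k" for j
    by (intro lpp_cong) auto
  have row: "lpp ?w j (Suc k) = lpp w j (Suc k)" if "j \<le> i" for j
    using that by (intro lpp_cong) auto
  have "lpp w i k \<le> lpp w i (Suc k)" "lpp w i k \<le> lpp w (Suc i) k"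
    by (rule lpp_Suc_column lpp_Suc_row)+
  then show ?thesis
    using assms by (auto simp: front_def sojourns_def column row fun_eq_iff max_def not_less_eq_eq le_Suc_eq)
qed

text \<open>The update touches only coordinate \<open>i\<close> and the gap;
  \<open>trials_burke\<close> preserves the law of this pair, which is independent of the other
  coordinates \<open>?R\<close>.\<close>

lemma sojourn_law_invariant:
  assumes "i \<in> {2..h}"
  shows "map_pmf (\<lambda>(c, u, d). (u(i := u i - d + c), d - u i + c))
      (pair_pmf (trials (p i)) (pair_pmf sojourn_law (trials a))) = pair_pmf sojourn_law (trials a)"
proof -
  let ?R = "Pi_pmf ({2..h} - {i}) 0 (\<lambda>i. trials (p i / a))"
  have "insert i ({2..h} - {i}) = {2..h}" using assms by auto
  then have law: "sojourn_law = do {f \<leftarrow> ?R; y \<leftarrow> trials (p i / a); return_pmf (f(i := y))}"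
    using Pi_pmf_insert'[of "{2..h} - {i}" i 0 "\<lambda>i. trials (p i / a)"]
    unfolding sojourn_law_def by (simp add: bind_commute_pmf[of "trials (p i / a)"])
  have "map_pmf (\<lambda>(c, u, d). (u(i := u i - d + c), d - u i + c))
      (pair_pmf (trials (p i)) (pair_pmf sojourn_law (trials a))) =
    do {c \<leftarrow> trials (p i); f \<leftarrow> ?R; y \<leftarrow> trials (p i / a); d \<leftarrow> trials a;
        return_pmf (f(i := y - d + c), d - y + c)}"
    by (simp add: law pair_pmf_def map_bind_pmf bind_assoc_pmf bind_return_pmf)
  also have "\<dots> = do {f \<leftarrow> ?R; y \<leftarrow> trials (p i / a); d \<leftarrow> trials a; c \<leftarrow> trials (p i);
        return_pmf (f(i := y - d + c), d - y + c)}"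
    by (simp add: bind_commute_pmf[of "trials (p i)"])
  also have "\<dots> = do {f \<leftarrow> ?R; (y, d) \<leftarrow> map_pmf (\<lambda>((u, d), c). (u - d + c, d - u + c))
      (pair_pmf (pair_pmf (trials (p i / a)) (trials a)) (trials (p i))); return_pmf (f(i := y), d)}"
    by (simp add: pair_pmf_def map_bind_pmf bind_assoc_pmf bind_return_pmf)
  also have "map_pmf (\<lambda>((u, d), c). (u - d + c, d - u + c))
      (pair_pmf (pair_pmf (trials (p i / a)) (trials a)) (trials (p i))) =
      pair_pmf (trials (p i / a)) (trials a)"
    using trials_burke[of a "p i / a"] a p[OF assms] by simp
  also have "do {f \<leftarrow> ?R; (y, d) \<leftarrow> pair_pmf (trials (p i / a)) (trials a); return_pmf (f(i := y), d)} =
      pair_pmf sojourn_law (trials a)"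
    by (simp add: law pair_pmf_def map_bind_pmf bind_assoc_pmf bind_return_pmf)
  finally show ?thesis .
qed

text \<open>Column \<open>Suc k\<close> is processed cell by cell from link 1 on; each new weight is
  independent of the current front.\<close>

lemma map_front:
  assumes sojourns: "map_pmf (sojourns k) (Pi_pmf ({1..h} \<times> {1..k}) 0 q) = sojourn_law"
    and "i < h" "k > 0"
  shows "map_pmf (front (Suc i) k) (Pi_pmf (front_cells (Suc i) k) 0 q) = pair_pmf sojourn_law (trials a)"
  using \<open>i < h\<close>
proof (induction i)
  case 0
  have "front_cells 0 k = {1..h} \<times> {1..k}" by (auto simp: front_cells_def)
  \<comment> \<open>At link 1 the departure gap is the fresh weight itself, which supplies the
    independent factor \<open>trials a\<close>.\<close>
  then have "map_pmf (front (Suc 0) k) (Pi_pmf (front_cells (Suc 0) k) 0 q) =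
      map_pmf (\<lambda>(c, w). (sojourns k w, c)) (pair_pmf (trials a) (Pi_pmf ({1..h} \<times> {1..k}) 0 q))"
    unfolding front_cells_Suc
    by (subst Pi_pmf_insert) (auto simp: pmf.map_comp o_def case_prod_unfold front_1 q_def p1)
  also have "\<dots> = map_pmf prod.swap (pair_pmf (trials a) sojourn_law)"
    unfolding sojourns[symmetric]
    by (simp add: pair_map_pmf2 pmf.map_comp o_def case_prod_unfold prod.swap_def)
  also have "\<dots> = pair_pmf sojourn_law (trials a)"
    by (subst pair_commute_pmf) (simp add: pmf.map_comp o_def case_prod_unfold prod.swap_def)
  finally show ?case .
next
  case (Suc i)
  have i: "Suc (Suc i) \<in> {2..h}" using Suc by auto
  \<comment> \<open>As \<open>k > 0\<close>, the new cell lies outside column 1, so its parameter is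
    \<open>p (Suc (Suc i))\<close> and not the ratio to \<open>a\<close>.\<close>
  have "map_pmf (front (Suc (Suc i)) k) (Pi_pmf (front_cells (Suc (Suc i)) k) 0 q) =
      map_pmf (\<lambda>(c, w). case front (Suc i) k w of (u, d) \<Rightarrow>
          (u(Suc (Suc i) := u (Suc (Suc i)) - d + c), d - u (Suc (Suc i)) + c))
        (pair_pmf (trials (p (Suc (Suc i)))) (Pi_pmf (front_cells (Suc i) k) 0 q))"
    unfolding front_cells_Suc[of "Suc i"] using \<open>k > 0\<close>
    by (subst Pi_pmf_insert)
      (auto simp: pmf.map_comp o_def case_prod_unfold front_Suc[OF i] q_def front_cells_def)
  also have "\<dots> = map_pmf (\<lambda>(c, u, d). (u(Suc (Suc i) := u (Suc (Suc i)) - d + c), d - u (Suc (Suc i)) + c))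
        (pair_pmf (trials (p (Suc (Suc i)))) (map_pmf (front (Suc i) k) (Pi_pmf (front_cells (Suc i) k) 0 q)))"
    by (simp add: pair_map_pmf2 pmf.map_comp o_def case_prod_unfold)
  also have "\<dots> = pair_pmf sojourn_law (trials a)"
    using Suc sojourn_law_invariant[OF i] by simp
  finally show ?case .
qed

text \<open>Column 1 starts in the stationary law because its sojourns are its own weights; each
  further column preserves it.\<close>

lemma map_sojourns:
  assumes "h > 0"
  shows "map_pmf (sojourns (Suc k)) (Pi_pmf ({1..h} \<times> {1..Suc k}) 0 q) = sojourn_law"
proof (induction k)
  case 0
  have "lpp w j (Suc 0) - lpp w (j - Suc 0) (Suc 0) = w (j, Suc 0)" if "2 \<le> j" for w j
    using that by (cases j) (auto simp: lpp_column_1)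
  then have "sojourns (Suc 0) = (\<lambda>w j. if j \<in> {2..h} then w (j, Suc 0) else 0)"
    by (auto simp: sojourns_def fun_eq_iff)
  then show ?case unfolding sojourn_law_def
    by (subst Pi_pmf_reindex[of "{1..h} \<times> {1..Suc 0}" "{2..h}" "\<lambda>j. (j, Suc 0)" _ q])
      (auto simp: q_def inj_on_def)
next
  case (Suc k)
  obtain i where h: "h = Suc i" using assms by (cases h) auto
  have cells: "front_cells h (Suc k) = {1..h} \<times> {1..Suc (Suc k)}"
    by (auto simp: front_cells_def)
  have "map_pmf fst (map_pmf (front h (Suc k)) (Pi_pmf (front_cells h (Suc k)) 0 q)) = sojourn_law"
    using map_front[OF Suc, of i] h by (simp add: map_fst_pair_pmf)
  moreover have "fst (front h (Suc k) w) = sojourns (Suc (Suc k)) w" for w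
    by (auto simp: front_def sojourns_def fun_eq_iff)
  ultimately show ?case by (simp add: pmf.map_comp o_def cells)
qed

lemma lpp_eq_row_1_plus_sojourns:
  assumes "h > 0"
  shows "lpp w h k = lpp w (Suc 0) k + (\<Sum>j\<in>{2..h}. sojourns k w j)"
proof -
  have "lpp w i k = lpp w (Suc 0) k + (\<Sum>j\<in>{2..i}. lpp w j k - lpp w (j - 1) k)" if "Suc 0 \<le> i" for i
    using that
  proof (induction i rule: dec_induct)
    case (step i)
    have "{2..Suc i} = insert (Suc i) {2..i}" using step.hyps by auto
    then have "(\<Sum>j\<in>{2..Suc i}. lpp w j k - lpp w (j - 1) k) =
        (lpp w (Suc i) k - lpp w i k) + (\<Sum>j\<in>{2..i}. lpp w j k - lpp w (j - 1) k)"
      by (simp only: finite_atLeastAtMost sum.insert) (simp del: lpp.simps)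
    then show ?case using step.IH lpp_Suc_row[of w i k] by linarith
  qed simp
  moreover have "(\<Sum>j\<in>{2..h}. sojourns k w j) = (\<Sum>j\<in>{2..h}. lpp w j k - lpp w (j - 1) k)"
    by (intro sum.cong refl) (simp only: sojourns_def if_True)
  ultimately show ?thesis using assms by (metis Suc_leI)
qed

lemma integrable_q:
  assumes "x \<in> {1..h} \<times> {1..k}"
  shows "integrable (q x) real"
proof -
  obtain i j where x: "x = (i, j)" by (cases x)
  have "1 \<le> i" "i \<le> h" using assms x by auto
  then consider "i = Suc 0" | "i \<in> {2..h}" by (cases "i = 1") auto
  then show ?thesis
  proof cases
    case 1
    then show ?thesis using a p1 by (simp add: x q_def integrable_trials)
  next
    case 2
    then have "0 \<le> p i / a" "p i / a < 1" "0 \<le> p i" "p i < 1"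
      using a p[OF 2] by auto
    then show ?thesis by (simp add: x q_def integrable_trials)
  qed
qed

text \<open>The time spent after link 1 is dominated by stationary sojourns, whose mean at link
  \<open>i\<close> is \<open>1 / (1 - p i / a)\<close>.\<close>

lemma mean_lpp_le:
  assumes "h > 0"
  shows "mean_lpp p h n \<le> real n / (1 - a) + (\<Sum>i\<in>{2..h}. a / (a - p i))"
proof -
  define A where "A = {1..h} \<times> {1..Suc n}"
  \<comment> \<open>The real packets occupy the columns from 2 on; \<open>s\<close> skips the
    virtual packet in column 1.\<close>
  define s where "s = (\<lambda>(i, k). (i, Suc k) :: nat \<times> nat)"
  let ?E = "measure_pmf.expectation (Pi_pmf A 0 q)"
  have s_mem: "s ` ({1..h} \<times> {1..n}) \<subseteq> A" "s ` ({1..Suc 0} \<times> {1..n}) \<subseteq> A"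
    using assms by (auto simp: s_def A_def)
  have s_inj: "inj_on s B" for B by (auto simp: s_def inj_on_def)
  have int: "integrable (q x) real" if "x \<in> A" for x
    using integrable_q that unfolding A_def .
  have q_s: "q (s (i, k)) = trials (p i)" if "k > 0" for i k
    using that by (simp add: q_def s_def)
  have s_int: "integrable (Pi_pmf A 0 q) (\<lambda>w. real (lpp (\<lambda>x. w (s x)) h n))"
    using s_mem int by (intro integrable_lpp) (auto simp: A_def)
  have s_int1: "integrable (Pi_pmf A 0 q) (\<lambda>w. real (lpp (\<lambda>x. w (s x)) (Suc 0) n))"
    using s_mem int by (intro integrable_lpp) (auto simp: A_def)
  have component: "map_pmf (\<lambda>w. sojourns (Suc n) w i) (Pi_pmf A 0 q) = trials (p i / a)"
    if "i \<in> {2..h}" for i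
  proof -
    have "map_pmf (\<lambda>w. sojourns (Suc n) w i) (Pi_pmf A 0 q) = map_pmf (\<lambda>u. u i) sojourn_law"
      unfolding A_def map_sojourns[OF assms, of n, symmetric] by (simp add: pmf.map_comp o_def)
    then show ?thesis using that by (simp add: sojourn_law_def Pi_pmf_component)
  qed
  have ratio: "0 \<le> p i / a" "p i / a < 1" if "i \<in> {2..h}" for i
    using a p[OF that] by auto
  have u_int: "integrable (Pi_pmf A 0 q) (\<lambda>w. real (sojourns (Suc n) w i))" if "i \<in> {2..h}" for i
    using integrable_trials[OF ratio[OF that]]
    by (simp add: component[OF that, symmetric] integrable_map_pmf_eq)
  have u_mean: "?E (\<lambda>w. real (sojourns (Suc n) w i)) = a / (a - p i)" if "i \<in> {2..h}" for i
    using expectation_trials[OF ratio[OF that]] a p[OF that]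
    by (simp add: component[OF that, symmetric] field_simps)
  have pointwise: "real (lpp (\<lambda>x. w (s x)) h n) \<le>
      real (lpp (\<lambda>x. w (s x)) (Suc 0) n) + (\<Sum>i\<in>{2..h}. real (sojourns (Suc n) w i))" for w
  proof -
    have shift: "(\<lambda>x. w (s x)) = (\<lambda>(i, k). w (i, Suc k))" by (auto simp: s_def)
    \<comment> \<open>Removing the virtual packet cannot lengthen a sojourn; summing over the links
      bounds the time spent after link 1.\<close>
    have "lpp (\<lambda>x. w (s x)) (Suc i) n + lpp w (Suc 0) (Suc n)
        \<le> lpp w (Suc i) (Suc n) + lpp (\<lambda>x. w (s x)) (Suc 0) n" for i
      unfolding shift
    proof (induction i)
      case (Suc i)
      then show ?case using lpp_delete_column(1)[of w "Suc i" n] by linarith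
    qed simp
    from this[of "h - 1"] have "lpp (\<lambda>x. w (s x)) h n \<le>
        lpp (\<lambda>x. w (s x)) (Suc 0) n + (\<Sum>i\<in>{2..h}. sojourns (Suc n) w i)"
      using lpp_eq_row_1_plus_sojourns[OF assms, of w "Suc n"]
      unfolding Suc_diff_1[OF assms] by linarith
    then show ?thesis unfolding of_nat_sum[symmetric] of_nat_add[symmetric] of_nat_le_iff .
  qed
  have "mean_lpp p h n = ?E (\<lambda>w. real (lpp (\<lambda>x. w (s x)) h n))"
    using s_mem q_s by (intro expectation_lpp_reindex[symmetric] s_inj) (auto simp: A_def)
  also have "\<dots> \<le> ?E (\<lambda>w. real (lpp (\<lambda>x. w (s x)) (Suc 0) n) +
      (\<Sum>i\<in>{2..h}. real (sojourns (Suc n) w i)))"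
    using pointwise by (intro integral_mono s_int Bochner_Integration.integrable_add s_int1
      Bochner_Integration.integrable_sum u_int) auto
  also have "\<dots> = ?E (\<lambda>w. real (lpp (\<lambda>x. w (s x)) (Suc 0) n)) +
      (\<Sum>i\<in>{2..h}. a / (a - p i))"
    using s_int1 u_int
    by (subst Bochner_Integration.integral_add)
      (auto simp: Bochner_Integration.integral_sum u_mean intro!: Bochner_Integration.integrable_sum)
  also have "?E (\<lambda>w. real (lpp (\<lambda>x. w (s x)) (Suc 0) n)) = mean_lpp p (Suc 0) n"
    using s_mem q_s by (intro expectation_lpp_reindex s_inj) (auto simp: A_def)
  finally show ?thesis using mean_lpp_row_1[of p n] a p1 by simp
qed

end

lemma mean_lpp_le_bottleneck_first:
  assumes "h > 0" "0 \<le> p (Suc 0)" "p (Suc 0) < 1"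
    and p: "\<And>i. i \<in> {2..h} \<Longrightarrow> 0 \<le> p i \<and> p i < p (Suc 0)"
  shows "mean_lpp p h n \<le> real n / (1 - p (Suc 0)) + (\<Sum>i\<in>{2..h}. p (Suc 0) / (p (Suc 0) - p i))"
proof (cases "p (Suc 0) = 0")
  case True
  \<comment> \<open>No erasure probability lies below 0, so link 1 is the only link. The locale
    excludes this case because it divides by \<open>a\<close>.\<close>
  then have "h = Suc 0" using p[of 2] \<open>h > 0\<close> by (cases "2 \<le> h") auto
  then show ?thesis using mean_lpp_row_1[of p n] assms by simp
next
  case False
  then interpret bottleneck_first "p (Suc 0)" h p
    using assms by unfold_locales auto
  show ?thesis using mean_lpp_le[OF \<open>h > 0\<close>] .
qed

section \<open>From link states to passage times\<close>

text \<open>From this time on the packet has arrived and its predecessor has left, so its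
  transmissions occupy \<open>{start w i k<..lpp w i k}\<close>.\<close>

definition start :: "(nat \<times> nat \<Rightarrow> nat) \<Rightarrow> nat \<Rightarrow> nat \<Rightarrow> nat" where
  "start w i k = max (lpp w (i - 1) k) (lpp w i (k - 1))"

lemma lpp_eq_start:
  assumes "1 \<le> i" "1 \<le> k"
  shows "lpp w i k = start w i k + w (i, k)"
  using assms by (cases i; cases k) (auto simp: start_def)

lemma inj_start_interval:
  assumes "t \<in> {start w i k<..lpp w i k}" "t \<in> {start w i k'<..lpp w i k'}"
  shows "k = k'"
proof (rule ccontr)
  have *: "lpp w i k1 \<le> start w i k2" if "k1 < k2" for k1 k2
    using lpp_mono[of i i k1 "k2 - 1" w] that by (simp add: start_def max.coboundedI2)
  assume "k \<noteq> k'"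
  then consider "k < k'" | "k' < k" by linarith
  then show False using *[of k k'] *[of k' k] assms by cases auto
qed

text \<open>The bits while link \<open>i\<close> idles are unconstrained.\<close>

definition schedule :: "nat \<Rightarrow> nat \<Rightarrow> (nat \<times> nat \<Rightarrow> nat) \<Rightarrow> (nat \<times> nat \<Rightarrow> bool) set" where
  "schedule l n w = {\<omega>. \<forall>i\<in>{1..l}. \<forall>k\<in>{1..n}. \<forall>t\<in>{start w i k<..lpp w i k}.
     \<omega> (t, i) \<longleftrightarrow> t = lpp w i k}"

section \<open>Outcomes realising a fixed weight matrix\<close>

locale passage_times =
  fixes l n :: nat and w :: "nat \<times> nat \<Rightarrow> nat"
  assumes w_pos: "\<And>i k. i \<in> {1..l} \<Longrightarrow> k \<in> {1..n} \<Longrightarrow> w (i, k) > 0"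
begin

text \<open>Induction on time for all nodes at once, since a rank update reads the upstream rank one
  time step earlier.\<close>

lemma le_rank_iff:
  assumes "\<omega> \<in> schedule l n w" "i \<le> l"
  shows "rank \<omega> n (Suc i) t \<le> n \<and> (\<forall>k\<le>n. k \<le> rank \<omega> n (Suc i) t \<longleftrightarrow> lpp w i k \<le> t)"
  using \<open>i \<le> l\<close>
proof (induction t arbitrary: i)
  case 0
  show ?case
  proof (cases i)
    case (Suc j)
    have "k \<le> 0 \<longleftrightarrow> lpp w i k \<le> 0" if "k \<le> n" for k
    proof (cases "k = 0")
      case False
      then show ?thesis using w_pos[of i k] lpp_eq_start[of i k w] that 0 Suc by auto
    qed simp
    then show ?thesis using Suc by simp
  qed simp
next
  case (Suc t)
  show ?case
  proof (cases i)
    case (Suc j)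
    define r where "r = rank \<omega> n (Suc i) t"
    have r: "r \<le> n" "\<And>k. k \<le> n \<Longrightarrow> k \<le> r \<longleftrightarrow> lpp w i k \<le> t"
      using Suc.IH[of i] Suc.prems by (auto simp: r_def)
    have pre: "rank \<omega> n i t \<le> n" "\<And>k. k \<le> n \<Longrightarrow> k \<le> rank \<omega> n i t \<longleftrightarrow> lpp w (i - 1) k \<le> t"
      using Suc.IH[of j] Suc.prems Suc by auto
    have step: "rank \<omega> n (Suc i) (Suc t) = r + (if \<omega> (Suc t, i) \<and> rank \<omega> n i t > r then 1 else 0)"
      using Suc by (simp add: r_def)
    \<comment> \<open>Once packet \<open>Suc r\<close> has started, the schedule fixes the bit of
      link \<open>i\<close>. Before that the sender has nothing innovative, and a positive weight
      excludes a crossing at \<open>Suc t\<close>.\<close>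
    have next_iff: "\<omega> (Suc t, i) \<and> rank \<omega> n i t > r \<longleftrightarrow> Suc r \<le> n \<and> lpp w i (Suc r) = Suc t"
    proof (cases "Suc r \<le> n")
      case True
      have late: "\<not> lpp w i (Suc r) \<le> t" using r(2)[OF True] by simp
      have "lpp w i r \<le> t" using r(1) r(2)[of r] by simp
      moreover have "rank \<omega> n i t > r \<longleftrightarrow> lpp w (i - 1) (Suc r) \<le> t"
        using pre(2)[OF True] by auto
      ultimately have start: "rank \<omega> n i t > r \<longleftrightarrow> start w i (Suc r) \<le> t"
        by (simp add: start_def)
      have eq: "lpp w i (Suc r) = start w i (Suc r) + w (i, Suc r)"
        using Suc by (intro lpp_eq_start) auto
      have pos: "w (i, Suc r) > 0" using w_pos[of i "Suc r"] True Suc Suc.prems by auto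
      show ?thesis
      proof (cases "start w i (Suc r) \<le> t")
        case started: True
        then have "\<omega> (Suc t, i) \<longleftrightarrow> Suc t = lpp w i (Suc r)"
          using assms(1) late True Suc Suc.prems unfolding schedule_def by (auto simp del: lpp.simps)
        then show ?thesis using True start started by auto
      next
        case False
        then show ?thesis using start eq pos by auto
      qed
    next
      case False
      then show ?thesis using pre by auto
    qed
    have "k \<le> rank \<omega> n (Suc i) (Suc t) \<longleftrightarrow> lpp w i k \<le> Suc t" if "k \<le> n" for k
    proof (cases "k \<le> r")
      case True
      then show ?thesis using r(2)[OF that] step by auto
    next
      case False
      have "\<not> lpp w i k \<le> t" using r(2)[OF that] False by simp
      \<comment> \<open>Positive weights separate the crossings, so no packet beyond
        \<open>Suc r\<close> is through at \<open>Suc t\<close>.\<close>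
      moreover have "lpp w i (Suc r) < lpp w i k" if "k \<noteq> Suc r"
      proof -
        have "lpp w i (Suc r) \<le> lpp w i (k - 1)" using False that by (intro lpp_mono) auto
        also have "\<dots> < lpp w i k"
          using lpp_eq_start[of i k w] w_pos[of i k] False \<open>k \<le> n\<close> Suc Suc.prems
          by (auto simp: start_def)
        finally show ?thesis .
      qed
      moreover have "\<not> lpp w i (Suc r) \<le> t" using r(2)[of "Suc r"] False that by simp
      ultimately show ?thesis
        unfolding step next_iff using False that
        by (cases "k = Suc r") (auto simp del: lpp.simps)
    qed
    moreover have "rank \<omega> n (Suc i) (Suc t) \<le> n"
      unfolding step using r(1) next_iff by auto
    ultimately show ?thesis by blast
  qed simp
qed

lemma completion_time_schedule:
  assumes "\<omega> \<in> schedule l n w"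
  shows "completion_time l n \<omega> = of_nat (lpp w l n)"
proof -
  have "rank \<omega> n (l + 1) t = n \<longleftrightarrow> lpp w l n \<le> t" for t
    using le_rank_iff[OF assms, of l t] by fastforce
  then have "(LEAST t. rank \<omega> n (l + 1) t = n) = lpp w l n" "\<exists>t. rank \<omega> n (l + 1) t = n"
    by (auto intro: Least_equality)
  then show ?thesis by (simp add: completion_time_def)
qed

text \<open>Each erased transmission contributes a factor \<open>p i\<close> and each successful
  last one \<open>1 - p i\<close>; over one interval they multiply to the geometric mass.\<close>

lemma emeasure_schedule:
  assumes p: "\<And>i. i \<in> {1..l} \<Longrightarrow> 0 \<le> p i \<and> p i < 1"
  shows "emeasure (line_space p) (schedule l n w) =
    (\<Prod>(i, k)\<in>{1..l} \<times> {1..n}. ennreal (pmf (trials (p i)) (w (i, k))))"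
proof -
  let ?M = "\<lambda>(t, i). measure_pmf (bernoulli_pmf (1 - p i)) :: bool measure"
  interpret P: product_prob_space ?M UNIV
    by (rule product_prob_spaceI) (auto simp: measure_pmf.prob_space_axioms split: prod.splits)
  define I where "I = (\<lambda>(i, k). {start w i k<..lpp w i k} \<times> {i})"
  \<comment> \<open>The prescribed bit is named without reference to the packet, so that the
    constraints form one family indexed by \<open>(t, i)\<close>.\<close>
  define on where "on = (\<lambda>(t, i). \<exists>k\<in>{1..n}. t = lpp w i k)"
  let ?B = "{1..l} \<times> {1..n}"
  have mem_last: "lpp w i k \<in> {start w i k<..lpp w i k}" if "(i, k) \<in> ?B" for i k
    using that w_pos[of i k] lpp_eq_start[of i k w] by auto
  have on: "on (t, i) \<longleftrightarrow> t = lpp w i k" if "(i, k) \<in> ?B" "t \<in> {start w i k<..lpp w i k}" for t i k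
  proof
    assume "on (t, i)"
    then obtain k' where "k' \<in> {1..n}" "t = lpp w i k'" by (auto simp: on_def)
    then show "t = lpp w i k" using inj_start_interval[of t w i k k'] mem_last[of i k'] that by auto
  qed (use that in \<open>auto simp: on_def\<close>)
  have space: "space (line_space p) = UNIV"
    by (auto simp: line_space_def space_PiM split_beta)
  have "schedule l n w = {x \<in> space (line_space p). \<forall>c\<in>\<Union>(I ` ?B). x c \<in> {on c}}"
    unfolding schedule_def space
  proof (intro Collect_cong iffI)
    fix x assume *: "\<forall>i\<in>{1..l}. \<forall>k\<in>{1..n}. \<forall>t\<in>{start w i k<..lpp w i k}. x (t, i) \<longleftrightarrow> t = lpp w i k"
    show "x \<in> UNIV \<and> (\<forall>c\<in>\<Union>(I ` ?B). x c \<in> {on c})"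
    proof (intro conjI UNIV_I ballI)
      fix c assume "c \<in> \<Union>(I ` ?B)"
      then obtain t i k where "c = (t, i)" "(i, k) \<in> ?B" "t \<in> {start w i k<..lpp w i k}"
        by (auto simp: I_def)
      then show "x c \<in> {on c}" using * on by blast
    qed
  next
    fix x assume *: "x \<in> UNIV \<and> (\<forall>c\<in>\<Union>(I ` ?B). x c \<in> {on c})"
    show "\<forall>i\<in>{1..l}. \<forall>k\<in>{1..n}. \<forall>t\<in>{start w i k<..lpp w i k}. x (t, i) \<longleftrightarrow> t = lpp w i k"
    proof (intro ballI)
      fix i k t assume ik: "i \<in> {1..l}" "k \<in> {1..n}" and t: "t \<in> {start w i k<..lpp w i k}"
      then have "(t, i) \<in> \<Union>(I ` ?B)" by (auto simp: I_def simp del: greaterThanAtMost_iff)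
      then show "x (t, i) \<longleftrightarrow> t = lpp w i k" using * on[of i k t] ik t by blast
    qed
  qed
  then have "emeasure (line_space p) (schedule l n w) =
      emeasure (line_space p) {x \<in> space (line_space p). \<forall>c\<in>\<Union>(I ` ?B). x c \<in> {on c}}"
    by (rule arg_cong)
  also have "\<dots> = (\<Prod>c\<in>\<Union>(I ` ?B). emeasure (?M c) {on c})"
    unfolding line_space_def by (rule P.emeasure_PiM_Collect) (auto simp: I_def)
  also have "\<dots> = (\<Prod>x\<in>?B. \<Prod>c\<in>I x. emeasure (?M c) {on c})"
  proof (rule prod.UNION_disjoint)
    show "\<forall>x\<in>?B. \<forall>y\<in>?B. x \<noteq> y \<longrightarrow> I x \<inter> I y = {}"
    proof (intro ballI impI equals0I)
      fix x y c assume "x \<noteq> y" and c: "c \<in> I x \<inter> I y"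
      obtain i k j k' where xy: "x = (i, k)" "y = (j, k')" by fastforce
      then have "j = i" using c by (auto simp: I_def)
      then have "fst c \<in> {start w i k<..lpp w i k}" "fst c \<in> {start w i k'<..lpp w i k'}"
        using c xy by (auto simp: I_def)
      then have "k = k'" by (rule inj_start_interval)
      then show False using \<open>x \<noteq> y\<close> xy \<open>j = i\<close> by simp
    qed
  qed (auto simp: I_def)
  also have "\<dots> = (\<Prod>(i, k)\<in>?B. ennreal (pmf (trials (p i)) (w (i, k))))"
  proof (intro prod.cong refl, clarify)
    fix i k assume ik: "i \<in> {1..l}" "k \<in> {1..n}"
    let ?L = "lpp w i k"
    have split: "{start w i k<..?L} = insert ?L {start w i k<..<?L}"
      using mem_last[of i k] ik by auto
    have "(\<Prod>c\<in>I (i, k). emeasure (?M c) {on c}) =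
        (\<Prod>t\<in>{start w i k<..?L}. ennreal (pmf (bernoulli_pmf (1 - p i)) (on (t, i))))"
    proof -
      have "I (i, k) = (\<lambda>t. (t, i)) ` {start w i k<..?L}" by (auto simp: I_def)
      then show ?thesis by (simp add: prod.reindex inj_on_def emeasure_pmf_single)
    qed
    also have "\<dots> = (\<Prod>t\<in>{start w i k<..?L}. ennreal (if t = ?L then 1 - p i else p i))"
      using on[of i k] ik p[of i] by (intro prod.cong refl) auto
    also have "\<dots> = ennreal (1 - p i) * (\<Prod>t\<in>{start w i k<..<?L}. ennreal (p i))"
      unfolding split by (subst prod.insert) (auto intro!: prod.cong)
    also have "\<dots> = ennreal ((1 - p i) * p i ^ (w (i, k) - 1))"
      using p[OF ik(1)] lpp_eq_start[of i k w] ik by (simp add: ennreal_mult ennreal_power)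
    also have "\<dots> = ennreal (pmf (trials (p i)) (w (i, k)))"
      using p[OF ik(1)] w_pos[OF ik] by (simp add: pmf_trials mult.commute)
    finally show "(\<Prod>c\<in>I (i, k). emeasure (?M c) {on c}) = ennreal (pmf (trials (p i)) (w (i, k)))" .
  qed
  finally show ?thesis .
qed

end


text \<open>The link states determine the ranks, these determine the crossing times by
  \<open>le_rank_iff\<close>, and a weight is a crossing time minus \<open>start\<close>.\<close>

lemma schedule_unique:
  assumes w: "\<And>x. x \<in> {1..l} \<times> {1..n} \<Longrightarrow> w x > 0" "\<And>x. x \<notin> {1..l} \<times> {1..n} \<Longrightarrow> w x = 0"
    and w': "\<And>x. x \<in> {1..l} \<times> {1..n} \<Longrightarrow> w' x > 0" "\<And>x. x \<notin> {1..l} \<times> {1..n} \<Longrightarrow> w' x = 0"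
    and \<omega>: "\<omega> \<in> schedule l n w" "\<omega> \<in> schedule l n w'"
  shows "w = w'"
proof
  fix x
  interpret P: passage_times l n w using w(1) by unfold_locales auto
  interpret P': passage_times l n w' using w'(1) by unfold_locales auto
  have eq: "lpp w i k = lpp w' i k" if "i \<le> l" "k \<le> n" for i k
    using P.le_rank_iff[OF \<omega>(1) that(1)] P'.le_rank_iff[OF \<omega>(2) that(1)] that(2)
    by (metis order.refl order.antisym)
  show "w x = w' x"
  proof (cases "x \<in> {1..l} \<times> {1..n}")
    case True
    then obtain i k where x: "x = (i, k)" "1 \<le> i" "i \<le> l" "1 \<le> k" "k \<le> n" by auto
    have "start w i k = start w' i k" using x eq by (simp add: start_def)
    then show ?thesis
      using lpp_eq_start[of i k w] lpp_eq_start[of i k w'] eq[of i k] x by simp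
  next
    case False
    then show ?thesis using w w' by simp
  qed
qed

section \<open>Transfer from completion times to passage times\<close>

text \<open>The schedule sets of the countably many matrices in the support are disjoint with masses
  adding up to 1, so they cover almost every outcome, and the completion time is constant on
  each.\<close>

lemma expected_T_eq:
  assumes p: "\<And>i. i \<in> {1..l} \<Longrightarrow> 0 \<le> p i \<and> p i < 1"
  shows "expected_T l p n = (\<integral>\<^sup>+w. of_nat (lpp w l n) \<partial>passage_law p l n)"
proof -
  let ?B = "{1..l} \<times> {1..n}"
  define S where "S = set_pmf (passage_law p l n)"
  have countable: "countable S" by (simp add: S_def)
  have w_pos: "w x > 0" if "w \<in> S" "x \<in> ?B" for w x
  proof -
    obtain i k where x: "x = (i, k)" by (cases x)
    have "w x \<in> set_pmf (trials (p i))"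
      using that x unfolding S_def passage_law_def by (auto simp: set_Pi_pmf PiE_dflt_def)
    then show ?thesis by (auto simp: trials_def)
  qed
  have w_out: "w x = 0" if "w \<in> S" "x \<notin> ?B" for w x
    using that set_Pi_pmf_subset[of ?B 0 "\<lambda>(i, k). trials (p i)"] unfolding S_def passage_law_def by blast
  have times: "passage_times l n w" if "w \<in> S" for w
    using w_pos[OF that] by unfold_locales auto
  have mass: "emeasure (line_space p) (schedule l n w) = pmf (passage_law p l n) w" if "w \<in> S" for w
  proof -
    have "emeasure (line_space p) (schedule l n w) = (\<Prod>(i, k)\<in>?B. ennreal (pmf (trials (p i)) (w (i, k))))"
      using passage_times.emeasure_schedule[OF times[OF that] p] by simp
    also have "\<dots> = ennreal (\<Prod>(i, k)\<in>?B. pmf (trials (p i)) (w (i, k)))"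
      by (subst prod_ennreal[symmetric]) (auto simp: case_prod_unfold)
    also have "(\<Prod>(i, k)\<in>?B. pmf (trials (p i)) (w (i, k))) = pmf (passage_law p l n) w"
      unfolding passage_law_def using w_out[OF that]
      by (subst pmf_Pi') (auto simp: case_prod_unfold)
    finally show ?thesis .
  qed
  \<comment> \<open>Nonzero measure already implies measurability, since \<open>emeasure\<close>
    vanishes on non-measurable sets.\<close>
  have sets: "schedule l n w \<in> sets (line_space p)" if "w \<in> S" for w
    using mass[OF that] that by (intro emeasure_neq_0_sets) (auto simp: S_def set_pmf_iff)
  have unique: "w = w'" if "w \<in> S" "w' \<in> S" "\<omega> \<in> schedule l n w" "\<omega> \<in> schedule l n w'" for w w' \<omega>
    by (rule schedule_unique[OF w_pos[OF that(1)] w_out[OF that(1)] w_pos[OF that(2)] w_out[OF that(2)] that(3,4)])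
  interpret P: prob_space "line_space p"
    unfolding line_space_def
    by (rule prob_space_PiM) (auto simp: measure_pmf.prob_space_axioms split: prod.splits)
  have "emeasure (line_space p) (\<Union>(schedule l n ` S)) =
      (\<integral>\<^sup>+w. emeasure (line_space p) (schedule l n w) \<partial>count_space S)"
    using sets countable unique by (intro emeasure_UN_countable) (auto simp: disjoint_family_on_def)
  also have "\<dots> = (\<integral>\<^sup>+w. pmf (passage_law p l n) w \<partial>count_space S)"
    by (intro nn_integral_cong) (simp add: mass)
  also have "\<dots> = 1"
    by (simp add: nn_integral_pmf S_def measure_pmf.emeasure_eq_measure measure_pmf.prob_eq_1 AE_measure_pmf)
  finally have "emeasure (line_space p) (\<Union>(schedule l n ` S)) = 1" .
  then have ae: "AE \<omega> in line_space p. \<omega> \<in> \<Union>(schedule l n ` S)"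
    by (intro P.AE_prob_1) (simp only: P.emeasure_eq_measure ennreal_eq_1)
  have "expected_T l p n = (\<integral>\<^sup>+\<omega>. (\<integral>\<^sup>+w. of_nat (lpp w l n) * indicator (schedule l n w) \<omega> \<partial>count_space S) \<partial>line_space p)"
    unfolding expected_T_def
  proof (rule nn_integral_cong_AE)
    show "AE \<omega> in line_space p. completion_time l n \<omega> =
        (\<integral>\<^sup>+w. of_nat (lpp w l n) * indicator (schedule l n w) \<omega> \<partial>count_space S)"
      using ae
    proof eventually_elim
      case (elim \<omega>)
      then obtain v where v: "v \<in> S" "\<omega> \<in> schedule l n v" by auto
      have "(\<integral>\<^sup>+w. of_nat (lpp w l n) * indicator (schedule l n w) \<omega> \<partial>count_space S) =
          (\<integral>\<^sup>+w. of_nat (lpp v l n) * indicator {v} w \<partial>count_space S)"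
        using v unique by (intro nn_integral_cong) (auto simp: indicator_def)
      also have "\<dots> = of_nat (lpp v l n)"
        using v by (subst nn_integral_cmult_indicator) auto
      finally show ?case
        using passage_times.completion_time_schedule[OF times[OF v(1)] v(2)] by simp
    qed
  qed
  also have "\<dots> = (\<integral>\<^sup>+w. (\<integral>\<^sup>+\<omega>. of_nat (lpp w l n) * indicator (schedule l n w) \<omega> \<partial>line_space p) \<partial>count_space S)"
    using countable sets by (intro nn_integral_count_space_nn_integral) auto
  also have "\<dots> = (\<integral>\<^sup>+w. ennreal (pmf (passage_law p l n) w) * of_nat (lpp w l n) \<partial>count_space S)"
    using sets mass by (intro nn_integral_cong) (simp add: nn_integral_cmult_indicator mult.commute)
  also have "\<dots> = (\<integral>\<^sup>+w. ennreal (pmf (passage_law p l n) w) * of_nat (lpp w l n) \<partial>count_space UNIV)"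
    by (subst nn_integral_count_space_indicator)
      (auto intro!: nn_integral_cong simp: S_def indicator_def set_pmf_iff)
  also have "\<dots> = (\<integral>\<^sup>+w. of_nat (lpp w l n) \<partial>passage_law p l n)"
    by (simp add: nn_integral_measure_pmf)
  finally show ?thesis .
qed

section \<open>The delay function\<close>

text \<open>Increments of a concave sequence never grow, so one increment below \<open>c\<close>
  would force the sequence under the line of slope \<open>c\<close> eventually.\<close>

lemma concave_above_linear_increment:
  fixes f :: "nat \<Rightarrow> real"
  assumes concave: "\<And>n. f (Suc (Suc n)) + f n \<le> 2 * f (Suc n)"
    and linear: "\<And>n. c * real n \<le> f n"
  shows "c \<le> f (Suc n) - f n"
proof (rule ccontr)
  assume *: "\<not> c \<le> f (Suc n) - f n"
  have gap: "f (Suc (n + k)) - f (n + k) \<le> f (Suc n) - f n" for k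
  proof (induction k)
    case (Suc k)
    then show ?case using concave[of "n + k"] by simp
  qed simp
  have upper: "f (n + k) \<le> f n + real k * (f (Suc n) - f n)" for k
  proof (induction k)
    case (Suc k)
    then show ?case using gap[of k] by (simp add: algebra_simps)
  qed simp
  have bound: "real k * (c - (f (Suc n) - f n)) \<le> f n - c * real n" for k
    using linear[of "n + k"] upper[of k] by (simp add: algebra_simps)
  obtain k where "f n - c * real n < real k * (c - (f (Suc n) - f n))"
    using reals_Archimedean3[of "c - (f (Suc n) - f n)"] * by auto
  with bound[of k] show False by simp
qed

section \<open>Mean passage times compared by coupling\<close>

locale line_network =
  fixes l :: nat and p :: "nat \<Rightarrow> real"
  assumes p: "\<And>i. i \<in> {1..l} \<Longrightarrow> 0 \<le> p i \<and> p i < 1"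
begin

lemma integrable_lpp_trials:
  assumes "h ` ({1..i} \<times> {1..k}) \<subseteq> {1..l} \<times> {1..n}"
  shows "integrable (passage_law p l n) (\<lambda>w. real (lpp (\<lambda>x. w (h x)) i k))"
  unfolding passage_law_def using assms p by (intro integrable_lpp) (auto intro: integrable_trials)

lemma expectation_lpp_passage_law:
  assumes "inj_on h ({1..i} \<times> {1..k})" "h ` ({1..i} \<times> {1..k}) \<subseteq> {1..l} \<times> {1..n}"
    and "\<And>x y. x \<in> {1..i} \<Longrightarrow> y \<in> {1..k} \<Longrightarrow> p (fst (h (x, y))) = p' x"
  shows "measure_pmf.expectation (passage_law p l n) (\<lambda>w. real (lpp (\<lambda>x. w (h x)) i k)) = mean_lpp p' i k"
  unfolding passage_law_def using assms
  by (intro expectation_lpp_reindex) (auto simp: case_prod_unfold)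

lemma expected_T_eq_mean_lpp: "expected_T l p n = ennreal (mean_lpp p l n)"
proof -
  have "(\<integral>\<^sup>+w. of_nat (lpp w l n) \<partial>passage_law p l n) = (\<integral>\<^sup>+w. ennreal (real (lpp w l n)) \<partial>passage_law p l n)"
    by (simp add: ennreal_of_nat_eq_real_of_nat)
  also have "\<dots> = ennreal (mean_lpp p l n)"
    unfolding mean_lpp_def using integrable_lpp_trials[of "\<lambda>x. x" l n n]
    by (intro nn_integral_eq_integral) auto
  finally show ?thesis using expected_T_eq[OF p] by simp
qed

text \<open>Columns 2 onward have the same law as columns 1 onward, so expectations in
  \<open>lpp_delete_column(2)\<close> give a second-difference inequality.\<close>

lemma mean_lpp_concave:
  "mean_lpp p l (Suc (Suc n)) + mean_lpp p l n \<le> 2 * mean_lpp p l (Suc n)"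
proof -
  define s where "s = (\<lambda>(i, k). (i, Suc k) :: nat \<times> nat)"
  let ?E = "measure_pmf.expectation (passage_law p l (Suc (Suc n)))"
  have sub: "s ` ({1..l} \<times> {1..k}) \<subseteq> {1..l} \<times> {1..Suc (Suc n)}" if "k \<le> Suc n" for k
    using that by (auto simp: s_def)
  have sub': "(\<lambda>x. x) ` ({1..l} \<times> {1..k}) \<subseteq> {1..l} \<times> {1..Suc (Suc n)}" if "k \<le> Suc (Suc n)" for k
    using that by auto
  have inj: "inj_on s B" for B by (auto simp: s_def inj_on_def)
  have shifted: "?E (\<lambda>w. real (lpp (\<lambda>x. w (s x)) l k)) = mean_lpp p l k" if "k \<le> Suc n" for k
    using inj sub[OF that] by (rule expectation_lpp_passage_law) (simp add: s_def)
  have plain: "?E (\<lambda>w. real (lpp w l k)) = mean_lpp p l k" if "k \<le> Suc (Suc n)" for k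
    using expectation_lpp_passage_law[OF _ sub'[OF that], of p] by simp
  note int = integrable_lpp_trials[OF sub] integrable_lpp_trials[OF sub']
  have le: "real (lpp w l (Suc (Suc n))) + real (lpp (\<lambda>x. w (s x)) l n)
      \<le> real (lpp (\<lambda>x. w (s x)) l (Suc n)) + real (lpp w l (Suc n))" for w
  proof -
    have "(\<lambda>x. w (s x)) = (\<lambda>(i, k). w (i, Suc k))" by (auto simp: s_def)
    then show ?thesis
      using lpp_delete_column(2)[of w l n] unfolding of_nat_add[symmetric] of_nat_le_iff by simp
  qed
  have "?E (\<lambda>w. real (lpp w l (Suc (Suc n))) + real (lpp (\<lambda>x. w (s x)) l n))
      \<le> ?E (\<lambda>w. real (lpp (\<lambda>x. w (s x)) l (Suc n)) + real (lpp w l (Suc n)))"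
    using le by (intro integral_mono Bochner_Integration.integrable_add int) auto
  then show ?thesis
    by (simp add: int Bochner_Integration.integral_add shifted plain)
qed

lemma mean_lpp_ge:
  assumes "m \<in> {1..l}"
  shows "1 / (1 - p m) * real n \<le> mean_lpp p l n"
proof -
  obtain j where m: "m = Suc j" using assms by (cases m) auto
  have int: "integrable (trials (p m)) real" using p[OF assms] by (simp add: integrable_trials)
  have comp: "integrable (passage_law p l n) (\<lambda>w. real (w (m, k)))"
    "measure_pmf.expectation (passage_law p l n) (\<lambda>w. real (w (m, k))) = 1 / (1 - p m)" if "k \<in> {1..n}" for k
    using integrable_Pi_pmf_component[of "{1..l} \<times> {1..n}" "(m, k)" "\<lambda>(i, k). trials (p i)"]
      expectation_Pi_pmf_component[of "{1..l} \<times> {1..n}" "(m, k)" "\<lambda>(i, k). trials (p i)"]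
      that assms int expectation_trials[of "p m"] p[OF assms]
    by (auto simp: passage_law_def)
  have le: "(\<Sum>k=1..n. real (w (m, k))) \<le> real (lpp w l n)" for w
    using sum_row_le_lpp[of w j n] lpp_mono[of m l n n w] assms m
    unfolding of_nat_sum[symmetric] of_nat_le_iff by fastforce
  have "1 / (1 - p m) * real n = measure_pmf.expectation (passage_law p l n) (\<lambda>w. \<Sum>k=1..n. real (w (m, k)))"
    using comp by (simp add: Bochner_Integration.integral_sum)
  also have "\<dots> \<le> mean_lpp p l n"
    unfolding mean_lpp_def using le comp integrable_lpp_trials[of "\<lambda>x. x" l n n]
    by (intro integral_mono Bochner_Integration.integrable_sum) auto
  finally show ?thesis .
qed

text \<open>Both networks in the bound contain link \<open>m\<close>, so
  \<open>n / (1 - p m)\<close> occurs twice on the right; the mean of row \<open>m\<close> alone, on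
  the left, cancels one copy.\<close>

lemma mean_lpp_le_bottleneck:
  assumes m: "m \<in> {1..l}" and worst: "\<And>i. i \<in> {1..l} \<Longrightarrow> i \<noteq> m \<Longrightarrow> p i < p m"
  shows "mean_lpp p l n \<le> real n / (1 - p m) + delay_bound l p m"
proof -
  \<comment> \<open>\<open>up\<close> lists the links from \<open>m\<close> back to 1 and
    \<open>down\<close> those from \<open>m\<close> on to \<open>l\<close>; in both, index 1 is the
    worst link.\<close>
  define up where "up = (\<lambda>i. p (Suc m - i))"
  define down where "down = (\<lambda>i. p (m - 1 + i))"
  define rev where "rev = (\<lambda>(i, k). (Suc m - i, Suc n - k))"
  define sat where "sat = (\<lambda>(i, k :: nat). (m - 1 + i, k))"
  let ?E = "measure_pmf.expectation (passage_law p l n)"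
  let ?h = "Suc (l - m)"
  have rev: "inj_on rev ({1..m} \<times> {1..n})" "rev ` ({1..m} \<times> {1..n}) \<subseteq> {1..l} \<times> {1..n}"
    using m by (auto simp: rev_def inj_on_def)
  have sat_inj: "inj_on sat B" for B by (auto simp: sat_def inj_on_def)
  have sat: "sat ` ({1..i} \<times> {1..n}) \<subseteq> {1..l} \<times> {1..n}" if "i \<le> ?h" for i
    using m that by (auto simp: sat_def)
  have id: "(\<lambda>x. x) ` ({1..l} \<times> {1..n}) \<subseteq> {1..l} \<times> {1..n}" by auto
  note int = integrable_lpp_trials[OF rev(2)] integrable_lpp_trials[OF sat] integrable_lpp_trials[OF id]
  \<comment> \<open>Saturating link \<open>m\<close> separates the downstream part; rotating the
    upstream part puts link \<open>m\<close> first there too.\<close>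
  have split: "real (lpp w l n) + real (lpp (\<lambda>x. w (sat x)) (Suc 0) n)
      \<le> real (lpp (\<lambda>x. w (rev x)) m n) + real (lpp (\<lambda>x. w (sat x)) ?h n)" for w
  proof -
    have "(\<lambda>x. w (rev x)) = (\<lambda>(i, k). w (Suc m - i, Suc n - k))"
      "(\<lambda>x. w (sat x)) = (\<lambda>(j, k). w (m - 1 + j, k))"
      by (auto simp: rev_def sat_def)
    moreover have "m - 1 + ?h = l" "Suc (m - 1) = m" using m by auto
    ultimately have "lpp w l n + lpp (\<lambda>x. w (sat x)) (Suc 0) n \<le> lpp w m n + lpp (\<lambda>x. w (sat x)) ?h n"
      and "lpp w m n \<le> lpp (\<lambda>x. w (rev x)) m n"
      using lpp_saturate[of w "m - 1" "l - m" n] lpp_reverse[of w m n] by simp_all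
    then show ?thesis unfolding of_nat_add[symmetric] of_nat_le_iff by linarith
  qed
  have "?E (\<lambda>w. real (lpp w l n) + real (lpp (\<lambda>x. w (sat x)) (Suc 0) n))
      \<le> ?E (\<lambda>w. real (lpp (\<lambda>x. w (rev x)) m n) + real (lpp (\<lambda>x. w (sat x)) ?h n))"
    using split by (intro integral_mono Bochner_Integration.integrable_add int) auto
  moreover have "?E (\<lambda>w. real (lpp (\<lambda>x. w (rev x)) m n)) = mean_lpp up m n"
    using rev by (intro expectation_lpp_passage_law) (auto simp: rev_def up_def)
  moreover have sat_mean: "?E (\<lambda>w. real (lpp (\<lambda>x. w (sat x)) i n)) = mean_lpp down i n" if "i \<le> ?h" for i
    using sat_inj sat[OF that] by (rule expectation_lpp_passage_law) (auto simp: sat_def down_def)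
  ultimately have le: "mean_lpp p l n + mean_lpp down (Suc 0) n \<le> mean_lpp up m n + mean_lpp down ?h n"
    using int by (simp add: Bochner_Integration.integral_add mean_lpp_def)
  have first: "down (Suc 0) = p m" "up (Suc 0) = p m" using m by (auto simp: up_def down_def)
  have pm: "0 \<le> p m" "p m < 1" using p[OF m] by auto
  have "mean_lpp down (Suc 0) n = real n / (1 - p m)"
    using mean_lpp_row_1[of down n] first pm by simp
  moreover have "mean_lpp up m n \<le> real n / (1 - p m) + (\<Sum>i\<in>{2..m}. p m / (p m - up i))"
  proof -
    have "0 \<le> up i \<and> up i < p m" if "i \<in> {2..m}" for i
    proof -
      have "Suc m - i \<in> {1..l}" "Suc m - i \<noteq> m" using that m by auto
      then show ?thesis unfolding up_def using p worst by blast
    qed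
    then show ?thesis using mean_lpp_le_bottleneck_first[of m up n] first pm m by auto
  qed
  moreover have "mean_lpp down ?h n \<le> real n / (1 - p m) + (\<Sum>i\<in>{2..?h}. p m / (p m - down i))"
  proof -
    have "0 \<le> down i \<and> down i < p m" if "i \<in> {2..?h}" for i
    proof -
      have "m - 1 + i \<in> {1..l}" "m - 1 + i \<noteq> m" using that m by auto
      then show ?thesis unfolding down_def using p worst by blast
    qed
    then show ?thesis using mean_lpp_le_bottleneck_first[of ?h down n] first pm by auto
  qed
  moreover have "(\<Sum>i\<in>{2..m}. p m / (p m - up i)) = (\<Sum>i\<in>{1..<m}. p m / (p m - p i))"
    by (rule sum.reindex_bij_witness[of _ "\<lambda>i. Suc m - i" "\<lambda>i. Suc m - i"]) (auto simp: up_def)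
  moreover have "(\<Sum>i\<in>{2..?h}. p m / (p m - down i)) = (\<Sum>i\<in>{m<..l}. p m / (p m - p i))"
    using m by (intro sum.reindex_bij_witness[of _ "\<lambda>i. Suc i - m" "\<lambda>i. m - 1 + i"]) (auto simp: down_def)
  moreover have "delay_bound l p m = (\<Sum>i\<in>{1..<m}. p m / (p m - p i)) + (\<Sum>i\<in>{m<..l}. p m / (p m - p i))"
  proof -
    have "{1..l} - {m} = {1..<m} \<union> {m<..l}" "{1..<m} \<inter> {m<..l} = {}" using m by auto
    then show ?thesis
      unfolding delay_bound_def by (simp only: sum.union_disjoint finite_atLeastLessThan finite_greaterThanAtMost)
  qed
  ultimately show ?thesis using le by linarith
qed

end

theorem theorem1:
  fixes l m :: nat and p :: "nat \<Rightarrow> real"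
  assumes "l \<ge> 1"
    and "\<And>i. i \<in> {1..l} \<Longrightarrow> 0 \<le> p i \<and> p i < 1"
    and "m \<in> {1..l}"
    and "\<And>i. i \<in> {1..l} \<Longrightarrow> i \<noteq> m \<Longrightarrow> p i < p m"
  shows "(\<forall>n\<ge>1. expected_T l p n < \<infinity>)
    \<and> (\<forall>n\<ge>1. delay l p m n \<le> delay l p m (Suc n))
    \<and> (\<forall>n\<ge>1. delay l p m n \<le> delay_bound l p m)"
proof -
  interpret line_network l p using assms(2) by unfold_locales
  have delay: "delay l p m n = mean_lpp p l n - real n / (1 - p m)" for n
    by (simp add: delay_def expected_T_eq_mean_lpp mean_lpp_nonneg)
  have "1 / (1 - p m) \<le> mean_lpp p l (Suc n) - mean_lpp p l n" for n
    by (rule concave_above_linear_increment) (rule mean_lpp_concave mean_lpp_ge[OF assms(3)])+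
  then have "delay l p m n \<le> delay l p m (Suc n)" for n
    unfolding delay by (simp add: add_divide_distrib algebra_simps)
  moreover have "delay l p m n \<le> delay_bound l p m" for n
    unfolding delay using mean_lpp_le_bottleneck[OF assms(3,4), of n] by simp
  ultimately show ?thesis by (simp add: expected_T_eq_mean_lpp)
qed

end
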